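(* Let $D\subset\mathbb{R}^2$ be a link diagram with Tait graph $T_D$ (an edge-signed plane graph), let $\mathcal{R}=\mathcal{R}_{T_D}$ be the unsigning of $T_D$, let $\Sigma=\Sigma_{T_D}$ be the closed orientable surface obtained from $\mathcal{R}$ by capping off its boundary components with discs, and let $\mathcal{M}_D=\mathcal{M}_{T_D}\subset\Sigma$ be the checkerboard coloured unsigned medial graph of $\mathcal{R}$. Let $\mathfrak{D}_D\subset\Sigma$ be the link diagram obtained from $\mathcal{M}_D$ by replacing each four-valent vertex with a crossing of negative sign (and forgetting the two-valent vertices). Then $$\langle D\rangle=\langle\mathfrak{D}_D\rangle .$$
   Context: **Kauffman bracket.** Let $\mathfrak{D}$ be a link diagram on an oriented surface ($\mathbb{R}^2$ or a closed surface $\Sigma$; a diagram on $\Sigma$ represents a link in $\Sigma\times I$). At a crossing, the A-smoothing merges the two regions swept out when the over-strand is rotated counterclockwise onto the under-strand; the B-smoothing is the other smoothing. A state $\mathfrak{s}$ is a choice of A- or B-smoothing at each crossing. Then $$\langle\mathfrak{D}\rangle=\sum_{\mathfrak{s}}A^{\alpha(\mathfrak{s})-\beta(\mathfrak{s})}\,(-A^2-A^{-2})^{c(\mathfrak{s})-1},$$ the sum being over all states, where $\alpha(\mathfrak{s})$, $\beta(\mathfrak{s})$ are the numbers of A- and B-smoothings and $c(\mathfrak{s})$ is the number of closed curves of the smoothed diagram. **Sign of a crossing.** In a diagram whose regions are checkerboard coloured black/white (adjacent regions have different colours), a crossing has sign $+$ if the A-smoothing locally merges the two black regions at the crossing (so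 the B-smoothing separates them), and sign $-$ if the A-smoothing separates the two black regions (so the B-smoothing merges them). **Tait graph.** Checkerboard colour the regions of $D\subset\mathbb{R}^2$ with the unbounded region white. $T_D$ is the plane graph with one vertex in each black region and one edge through each crossing, joining the (possibly equal) vertices of the black regions meeting there; each edge carries the sign of its crossing. **Ribbon graphs.** A ribbon graph is an orientable surface with boundary, presented as a union of discs (vertices) and ribbons $I\times I$, $I=[0,1]$ (edges), such that discs and ribbons meet in disjoint segments $\{0,1\}\times I$, each such segment lies on the boundary of exactly one disc and exactly one ribbon, and every ribbon contains exactly two such segments. **Unsigning $\mathcal{R}_G$ of an edge-signed plane graph $G$.** Let $\mathcal{G}$ be the fattening of $G$: the plane surface obtained by thickening each vertex to a disc and each edge $e$ to a ribbon $I\times I$ attached to the vertex discs along $\{0,1\}\times I$. Let $N_+\subset\mathbb{R}^2$ be the union of all vertex discs and of the ribbons of the positive edges; $\partial N_+$ is a collection of disjoint simple closed curves. The ribbon graph $\mathcal{R}_G$ has one (abstract) disc for each curve of $\partial N_+$, with that curve as boundary, and one ribbon for each edge $e$ of $G$: if $e$ is negative, its ribbon is the ribbon $I\times I$ of $e$ in $\mathcal{G}$, attached to $\partial N_+$ along $\{0,1\}\times I$; if $e$ is positive, its ribbon is the transverse band $[1/3,2/3]\times I$ inside the ribbon $I\times I$ of $e$, attached to $\partial N_+$ along $[1/3,2/3]\times\{0,1\}$. The resulting abstract surface is orientable. **Surface $\Sigma_G$ and medial graph $\mathcal{M}_G$.** $\Sigma_G$ is the closed orientable surface obtained from $\mathcal{R}_G$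 by gluing a disc to each boundary component. Identify each ribbon $e$ of $\mathcal{R}_G$ with $I\times I$, attached to discs along $\{0,1\}\times I$. The graph $\mathcal{M}_G\subset\mathcal{R}_G\subset\Sigma_G$ has a vertex $v_e$ at the midpoint of each ribbon $e$ and vertices $v_{e_1},v_{e_2},v_{e_3},v_{e_4}$ at its corners $(0,0),(0,1),(1,0),(1,1)$; edges $(v_e,v_{e_i})$, $i=1,\dots,4$, inside the ribbon $e$; and, for each arc of the boundary of a disc of $\mathcal{R}_G$ that joins two corner vertices and does not run along a ribbon end, an edge inside the disc joining these two vertices parallel to that arc. The vertices $v_e$ are four-valent; all others are two-valent. Colour black the regions of $\mathcal{M}_G\subset\Sigma_G$ that are contained in $\mathcal{R}_G$, and all other regions white; this is the checkerboard colouring, and at $v_e$ the two black corners are those facing the ends $\{0\}\times I$ and $\{1\}\times I$ of the ribbon.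
   Formalization: Every black region of D is assumed to be a disc (two concentric circles violate the claim otherwise), and a disc of the unsigning with no ribbons contributes a crossingless circle to the medial graph (otherwise the claim fails for a single circle). *)

theory Defs
  imports "HOL-Combinatorics.Orbits" "HOL-Computational_Algebra.Formal_Laurent_Series"
begin

section \<open>Link diagrams on oriented surfaces\<close>

text \<open>
  Graphs on oriented surfaces are encoded as combinatorial maps. A four-valent graph is given by its
  darts (half-edges at the crossings); \<^term>\<open>rot d\<close> is the next dart counterclockwise around
  the crossing of \<^term>\<open>d\<close>, and \<^term>\<open>flip d\<close> is the other half of the edge containing
  \<^term>\<open>d\<close>. Closed curves without crossings are listed separately in \<^term>\<open>circles\<close>.

  The dart \<^term>\<open>d\<close> also names a corner, namely the one swept out when \<^term>\<open>d\<close> is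
  rotated counterclockwise onto \<^term>\<open>rot d\<close>.
\<close>

record ('d, 'c) shadow =
  darts :: "'d set"
  rot :: "'d \<Rightarrow> 'd"
  flip :: "'d \<Rightarrow> 'd"
  circles :: "'c set"

record ('d, 'c) diagram = "('d, 'c) shadow" +
  over :: "'d set"

definition link_diagram :: "('d, 'c, 'z) diagram_scheme \<Rightarrow> bool" where
  "link_diagram D \<longleftrightarrow>
     finite (darts D) \<and> finite (circles D) \<and>
     rot D permutes darts D \<and>
     (\<forall>d \<in> darts D. (rot D ^^ 4) d = d \<and> (rot D ^^ 2) d \<noteq> d) \<and>
     flip D permutes darts D \<and>
     (\<forall>d \<in> darts D. flip D (flip D d) = d \<and> flip D d \<noteq> d) \<and>
     over D \<subseteq> darts D \<and>
     (\<forall>d \<in> darts D. rot D d \<in> over D \<longleftrightarrow> d \<notin> over D)"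

definition crossing :: "('d, 'c, 'z) shadow_scheme \<Rightarrow> 'd \<Rightarrow> 'd set" where
  "crossing D d = orbit (rot D) d"

definition crossings :: "('d, 'c, 'z) shadow_scheme \<Rightarrow> 'd set set" where
  "crossings D = crossing D ` darts D"

definition edges :: "('d, 'c, 'z) shadow_scheme \<Rightarrow> 'd set set" where
  "edges D = (\<lambda>d. {d, flip D d}) ` darts D"


section \<open>The Kauffman bracket\<close>

text \<open>
  A state is the set \<^term>\<open>S\<close> of crossings that receive the A-smoothing. The A-smoothing merges
  the two corners named by over-darts, the B-smoothing the two corners named by under-darts. An arc
  of the smoothed diagram joins \<^term>\<open>d\<close> and \<^term>\<open>rot D d\<close> exactly when the corner
  \<^term>\<open>d\<close> is cut off, that is, not merged.
\<close>

definition merged_corners :: "('d, 'c, 'z) diagram_scheme \<Rightarrow> 'd set set \<Rightarrow> 'd set" where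
  "merged_corners D S = {d \<in> darts D. crossing D d \<in> S \<longleftrightarrow> d \<in> over D}"

definition smooth :: "('d, 'c, 'z) diagram_scheme \<Rightarrow> 'd set set \<Rightarrow> 'd \<Rightarrow> 'd" where
  "smooth D S d = (if d \<in> merged_corners D S then inv (rot D) d else rot D d)"

definition strands :: "('d, 'c, 'z) diagram_scheme \<Rightarrow> 'd set set \<Rightarrow> 'd rel" where
  "strands D S = (\<Union>d \<in> darts D. {(d, flip D d), (d, smooth D S d)})"

definition num_curves :: "('d, 'c, 'z) diagram_scheme \<Rightarrow> 'd set set \<Rightarrow> nat" where
  "num_curves D S = card (darts D // (strands D S)\<^sup>*) + card (circles D)"

text \<open>
  The bracket is a Laurent polynomial in the indeterminate \<open>A\<close>; it is taken in a field so that
  the exponent \<open>c(s) - 1 = -1\<close> of the empty diagram makes sense.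
\<close>

definition bracket :: "('d, 'c, 'z) diagram_scheme \<Rightarrow> rat fls" where
  "bracket D = (let A = fls_X in
     \<Sum>S \<in> Pow (crossings D).
       A powi (int (card S) - int (card (crossings D - S))) *
       (- (A powi 2) - A powi (-2)) powi (int (num_curves D S) - 1))"


section \<open>Plane link diagrams and checkerboard colourings\<close>

text \<open>
  A diagram in the plane need not be connected, so a region may have several boundary curves. The
  sides of the diagram are its corners and the two sides \<^term>\<open>(c, True)\<close>, \<^term>\<open>(c, False)\<close>
  of each crossingless circle \<^term>\<open>c\<close>; \<^term>\<open>region\<close> tells in which region a side lies.
\<close>

record ('d, 'c, 'r) plane_diagram = "('d, 'c) diagram" +
  region :: "'d + 'c \<times> bool \<Rightarrow> 'r"
  unbounded :: 'r

definition regions :: "('d, 'c, 'r, 'z) plane_diagram_scheme \<Rightarrow> 'r set" where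
  "regions D = insert (unbounded D) (region D ` (darts D <+> circles D \<times> UNIV))"

text \<open>The next corner on the boundary walk that keeps the region on its left.\<close>

definition face_next :: "('d, 'c, 'z) shadow_scheme \<Rightarrow> 'd \<Rightarrow> 'd" where
  "face_next D d = inv (rot D) (flip D d)"

definition boundary_curves :: "('d, 'c, 'z) shadow_scheme \<Rightarrow> ('d + 'c \<times> bool) set set" where
  "boundary_curves D =
     (\<lambda>d. Inl ` orbit (face_next D) d) ` darts D \<union> (\<lambda>x. {Inr x}) ` (circles D \<times> UNIV)"

definition curves_of_region ::
    "('d, 'c, 'r, 'z) plane_diagram_scheme \<Rightarrow> 'r \<Rightarrow> ('d + 'c \<times> bool) set set" where
  "curves_of_region D r = {b \<in> boundary_curves D. region D ` b = {r}}"

definition adjacent :: "('d, 'c, 'r, 'z) plane_diagram_scheme \<Rightarrow> 'r rel" where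
  "adjacent D =
     (\<lambda>d. (region D (Inl d), region D (Inl (rot D d)))) ` darts D \<union>
     (\<lambda>(c, b). (region D (Inr (c, b)), region D (Inr (c, \<not> b)))) ` (circles D \<times> UNIV)"

text \<open>
  Gluing into the boundary curves of each region a sphere with that many holes yields a closed
  oriented surface. The diagram lies in the sphere (and, after removing a point of the unbounded
  region, in the plane) iff this surface is connected and has Euler characteristic 2. A circle
  contributes 0 to the number of vertices minus the number of edges.
\<close>

definition plane_link_diagram :: "('d, 'c, 'r, 'z) plane_diagram_scheme \<Rightarrow> bool" where
  "plane_link_diagram D \<longleftrightarrow>
     link_diagram D \<and>
     (\<forall>d \<in> darts D. region D (Inl (face_next D d)) = region D (Inl d)) \<and>
     (\<forall>r \<in> regions D. \<forall>r' \<in> regions D. (r, r') \<in> (adjacent D)\<^sup>*) \<and>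
     int (card (crossings D)) - int (card (edges D))
       + (\<Sum>r \<in> regions D. 2 - int (card (curves_of_region D r))) = 2"

definition checkerboard :: "('d, 'c, 'r, 'z) plane_diagram_scheme \<Rightarrow> ('r \<Rightarrow> bool) \<Rightarrow> bool" where
  "checkerboard D black \<longleftrightarrow>
     \<not> black (unbounded D) \<and> (\<forall>(r, r') \<in> adjacent D. black r \<noteq> black r')"

text \<open>
  A bounded region of a plane diagram is an open disc iff it has exactly one boundary curve. (If
  \<^term>\<open>D\<close> is connected, all bounded regions are discs.)
\<close>

definition disc_region :: "('d, 'c, 'r, 'z) plane_diagram_scheme \<Rightarrow> 'r \<Rightarrow> bool" where
  "disc_region D r \<longleftrightarrow> card (curves_of_region D r) = 1"

text \<open>
  Signs of a crossing \<^term>\<open>x\<close>, given the set \<^term>\<open>B\<close> of black corners: the corners merged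
  by the A-smoothing are those in \<^term>\<open>over D\<close>.
\<close>

definition positive_crossing :: "('d, 'c, 'z) diagram_scheme \<Rightarrow> 'd set \<Rightarrow> 'd set \<Rightarrow> bool" where
  "positive_crossing D B x \<longleftrightarrow> x \<inter> over D = x \<inter> B"

definition negative_crossing :: "('d, 'c, 'z) diagram_scheme \<Rightarrow> 'd set \<Rightarrow> 'd set \<Rightarrow> bool" where
  "negative_crossing D B x \<longleftrightarrow> x \<inter> over D = x - B"


section \<open>Ribbon graphs and Tait graphs\<close>

text \<open>
  An oriented ribbon graph. A half-edge is an end of a ribbon; \<^term>\<open>opposite\<close> gives the other
  end of the ribbon, and \<^term>\<open>next_half\<close> the next ribbon end counterclockwise on the boundary
  of the same disc. A plane graph is identified with its fattening; the discs are indexed by the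
  vertices.
\<close>

record ('h, 'v) ribbon_graph =
  half_edges :: "'h set"
  next_half :: "'h \<Rightarrow> 'h"
  opposite :: "'h \<Rightarrow> 'h"
  verts :: "'v set"
  vert_of :: "'h \<Rightarrow> 'v"

record ('h, 'v) signed_graph = "('h, 'v) ribbon_graph" +
  positive :: "'h set"

definition isolated :: "('h, 'v, 'z) ribbon_graph_scheme \<Rightarrow> 'v set" where
  "isolated G = verts G - vert_of G ` half_edges G"

text \<open>
  The half-edges of the Tait graph are the black corners: the edge through a crossing leaves it
  through the black corners \<^term>\<open>d\<close> and \<^term>\<open>(rot D ^^ 2) d\<close>. Around a vertex placed in a
  black disc, the half-edges are ordered as the corners are on the counterclockwise boundary walk.
  This determines the plane graph only if the black regions are discs.
\<close>

definition black_corners :: "('d, 'c, 'r, 'z) plane_diagram_scheme \<Rightarrow> ('r \<Rightarrow> bool) \<Rightarrow> 'd set" where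
  "black_corners D black = {d \<in> darts D. black (region D (Inl d))}"

definition tait_graph ::
    "('d, 'c, 'r, 'z) plane_diagram_scheme \<Rightarrow> ('r \<Rightarrow> bool) \<Rightarrow> ('d, 'r) signed_graph" where
  "tait_graph D black = (let B = black_corners D black in
     \<lparr> half_edges = B,
       next_half = perm_restrict (face_next D) B,
       opposite = perm_restrict (rot D ^^ 2) B,
       verts = {r \<in> regions D. black r},
       vert_of = (\<lambda>d. region D (Inl d)),
       positive = {d \<in> B. positive_crossing D B (crossing D d)} \<rparr>)"


section \<open>Unsigning\<close>

text \<open>
  The ribbons of the unsigning meet the boundary of \<open>N\<^sub>+\<close> in one segment per half-edge of
  \<^term>\<open>G\<close>. For a negative half-edge \<^term>\<open>h\<close> this is the ribbon end \<^term>\<open>h\<close> itself. The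
  transverse band of a positive edge with ends \<^term>\<open>h\<close> and \<^term>\<open>opposite G h\<close> has its two
  ends on the two long sides of the ribbon; the end on the side that lies to the right when leaving
  along \<^term>\<open>h\<close> is named \<^term>\<open>h\<close>.

  Follow the boundary with \<open>N\<^sub>+\<close> on the left. After the segment of a negative \<^term>\<open>h\<close> one
  stays on the same vertex disc and meets \<^term>\<open>next_half G h\<close>; after the segment of a positive
  \<^term>\<open>h\<close> one arrives at the far end of the ribbon, \<^term>\<open>opposite G h\<close>, and continues from
  there.
\<close>

definition boundary_next :: "('h, 'v, 'z) signed_graph_scheme \<Rightarrow> 'h \<Rightarrow> 'h" where
  "boundary_next G h = next_half G (if h \<in> positive G then opposite G h else h)"

text \<open>
  The curves of the boundary of \<open>N\<^sub>+\<close>: those meeting ribbons of the unsigning, identified with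
  the set of segments on them, and the boundary curves of the isolated vertices.

  With the boundary orientation of \<open>N\<^sub>+\<close> on the new discs, negative ribbons (outside \<open>N\<^sub>+\<close>,
  with the orientation of the plane) and positive bands (inside \<open>N\<^sub>+\<close>, with the opposite
  orientation) are attached compatibly, so \<^const>\<open>boundary_next\<close> is the counterclockwise order.
\<close>

definition unsigning :: "('h, 'v, 'z) signed_graph_scheme \<Rightarrow> ('h, 'h set + 'v) ribbon_graph" where
  "unsigning G =
     \<lparr> half_edges = half_edges G,
       next_half = boundary_next G,
       opposite = opposite G,
       verts = orbit (boundary_next G) ` half_edges G <+> isolated G,
       vert_of = (\<lambda>h. Inl (orbit (boundary_next G) h)) \<rparr>"


section \<open>The medial diagram with negative crossings\<close>

text \<open>
  The medial graph of a ribbon graph, with its two-valent vertices forgotten. It lies in the closed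
  surface obtained by capping off the ribbon graph, oriented as the ribbon graph. The corners of a
  ribbon are \<^term>\<open>(h, False)\<close> and \<^term>\<open>(h, True)\<close>, the first and the second corner of the
  end \<^term>\<open>h\<close> in the counterclockwise order of the disc boundary. They also name the half-edges
  from the midpoint of the ribbon to its corners, whose counterclockwise cyclic order is
  \<^term>\<open>(h, True)\<close>, \<^term>\<open>(h, False)\<close>, \<^term>\<open>(opposite R h, True)\<close>,
  \<^term>\<open>(opposite R h, False)\<close>. The arcs along the disc boundary run from
  \<^term>\<open>(h, True)\<close> to \<^term>\<open>(next_half R h, False)\<close>. The black corner facing the end
  \<^term>\<open>h\<close> lies between \<^term>\<open>(h, True)\<close> and \<^term>\<open>(h, False)\<close>. On a disc without
  ribbons the medial graph is, by convention, a circle.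
\<close>

record ('d, 'c) coloured_shadow = "('d, 'c) shadow" +
  black :: "'d set"

definition medial_graph ::
    "('h, 'v, 'z) ribbon_graph_scheme \<Rightarrow> ('h \<times> bool, 'v) coloured_shadow" where
  "medial_graph R = (let H = half_edges R \<times> UNIV in
     \<lparr> darts = H,
       rot = perm_restrict (\<lambda>(h, b). if b then (h, False) else (opposite R h, True)) H,
       flip = perm_restrict
         (\<lambda>(h, b). if b then (next_half R h, False) else (inv (next_half R) h, True)) H,
       circles = isolated R,
       black = half_edges R \<times> {True} \<rparr>)"

definition all_negative :: "('d, 'c, 'z) coloured_shadow_scheme \<Rightarrow> ('d, 'c) diagram" where
  "all_negative M =
     \<lparr> darts = darts M, rot = rot M, flip = flip M, circles = circles M,
       over = darts M - black M \<rparr>"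

lemma all_negative_crossing:
  assumes "rot M permutes darts M" and "x \<in> crossings (all_negative M)"
  shows "negative_crossing (all_negative M) (black M) x"
proof -
  have "x \<subseteq> darts M"
    using assms permutes_orbit_subset[OF assms(1)]
    by (auto simp: crossings_def crossing_def all_negative_def)
  then show ?thesis
    by (auto simp: negative_crossing_def all_negative_def)
qed

end

theory Submission
  imports Defs
begin

text \<open>
  Every dart of a checkerboard coloured diagram bounds exactly one black corner, so the darts are
  \<open>B \<times> {True, False}\<close> for the set \<open>B\<close> of black corners, just as for the medial graph of the
  unsigning. At negative crossings identify the darts of both diagrams in the obvious way; at
  positive crossings exchange the two darts \<open>(h, True)\<close> and \<open>(h', True)\<close>, where \<open>h\<close>, \<open>h'\<close> are the
  two black corners. The exchange turns the boundary walk of the black regions into the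
  walk along the boundary of \<open>N\<^sub>+\<close>, and it swaps the two ways of joining the darts at a positive
  crossing. So the A-smoothings of the two diagrams have the same strands, whatever the signs.
\<close>

section \<open>Invariance of the bracket under bijections of darts\<close>

lemma card_quotient_conjugate:
  assumes "bij_betw f A B" and "r \<subseteq> A \<times> A"
  shows "card (B // (map_prod f f ` r)\<^sup>*) = card (A // r\<^sup>*)"
proof -
  let ?s = "map_prod f f ` r"
  have inj: "inj_on f A" and im: "f ` A = B"
    using assms(1) by (auto simp: bij_betw_def)
  have closed: "y \<in> A" if "(x, y) \<in> r\<^sup>*" "x \<in> A" for x y
    using that by (induction rule: rtrancl_induct) (use assms(2) in auto)
  have "?s\<^sup>* `` {f x} = f ` (r\<^sup>* `` {x})" if x: "x \<in> A" for x
  proof (intro equalityI subsetI)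
    fix z assume "z \<in> ?s\<^sup>* `` {f x}"
    then have "(f x, z) \<in> ?s\<^sup>*" by simp
    then show "z \<in> f ` (r\<^sup>* `` {x})"
    proof (induction rule: rtrancl_induct)
      case (step y z)
      then obtain a where a: "(x, a) \<in> r\<^sup>*" "y = f a" by auto
      from step obtain b c where bc: "(b, c) \<in> r" "y = f b" "z = f c" by auto
      \<comment> \<open>Both lie in \<open>A\<close>, where \<open>f\<close> is injective, so a
        chain starting at \<open>f x\<close> lifts step by step.\<close>
      have "a = b"
        using a bc closed[OF a(1) x] assms(2) inj by (auto dest: inj_onD)
      with a bc show ?case by (auto intro: rtrancl_into_rtrancl)
    qed auto
  next
    fix z assume "z \<in> f ` (r\<^sup>* `` {x})"
    then obtain y where "(x, y) \<in> r\<^sup>*" and z: "z = f y" by auto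
    then have "(f x, f y) \<in> ?s\<^sup>*"
    proof (induction arbitrary: z rule: rtrancl_induct)
      case (step y w)
      then have "(f y, f w) \<in> ?s" by force
      with step show ?case by (auto intro: rtrancl_into_rtrancl)
    qed auto
    with z show "z \<in> ?s\<^sup>* `` {f x}" by simp
  qed
  then have "B // ?s\<^sup>* = image f ` (A // r\<^sup>*)"
    unfolding im[symmetric] quotient_def by auto
  moreover have "inj_on (image f) (A // r\<^sup>*)"
    by (rule inj_on_subset[OF inj_on_image_Pow[OF inj]]) (use closed in \<open>auto simp: quotient_def\<close>)
  ultimately show ?thesis
    by (simp add: card_image)
qed

text \<open>
  The rotation need not be preserved by \<^term>\<open>f\<close>: the order of the darts around a crossing may
  change.
\<close>

lemma bracket_eqI:
  assumes bij: "bij_betw f (darts D) (darts E)"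
    and crossing: "\<And>d. d \<in> darts D \<Longrightarrow> crossing E (f d) = f ` crossing D d"
    and crossing_sub: "\<And>d. d \<in> darts D \<Longrightarrow> crossing D d \<subseteq> darts D"
    and flip_mem: "\<And>d. d \<in> darts D \<Longrightarrow> flip D d \<in> darts D"
    and flip: "\<And>d. d \<in> darts D \<Longrightarrow> flip E (f d) = f (flip D d)"
    and smooth_mem: "\<And>S d. d \<in> darts D \<Longrightarrow> smooth D S d \<in> darts D"
    and smooth: "\<And>S d. S \<subseteq> crossings D \<Longrightarrow> d \<in> darts D \<Longrightarrow>
                   smooth E (image f ` S) (f d) = f (smooth D S d)"
    and circles: "card (circles D) = card (circles E)"
  shows "bracket D = bracket E"
proof -
  have inj: "inj_on f (darts D)" and im: "f ` darts D = darts E"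
    using bij by (auto simp: bij_betw_def)
  have injc: "inj_on (image f) (crossings D)"
    by (rule inj_on_subset[OF inj_on_image_Pow[OF inj]])
       (use crossing_sub in \<open>auto simp: crossings_def\<close>)
  have imc: "image f ` crossings D = crossings E"
    using crossing by (auto simp: crossings_def im[symmetric] image_iff)
  \<comment> \<open>A crossing is a set of darts and a state a set of crossings, so \<open>f\<close>
    acts on states by a double image.\<close>
  have bijc: "bij_betw (image (image f)) (Pow (crossings D)) (Pow (crossings E))"
    by (rule bij_betw_Pow) (use injc imc in \<open>simp add: bij_betw_def\<close>)
  have curves: "num_curves E (image f ` S) = num_curves D S" if S: "S \<subseteq> crossings D" for S
  proof -
    have "strands E (image f ` S) = map_prod f f ` strands D S"
      using flip smooth[OF S] by (auto simp: strands_def im[symmetric])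
    moreover have "strands D S \<subseteq> darts D \<times> darts D"
      using flip_mem smooth_mem by (auto simp: strands_def)
    ultimately show ?thesis
      using card_quotient_conjugate[OF bij] circles by (simp add: num_curves_def)
  qed
  have card: "card (image f ` S) = card S" if "S \<subseteq> crossings D" for S
    by (rule card_image) (rule inj_on_subset[OF injc that])
  have diff: "crossings E - image f ` S = image f ` (crossings D - S)" if "S \<subseteq> crossings D" for S
    using inj_on_image_set_diff[OF injc _ that, of "crossings D"] imc by auto
  show ?thesis
    unfolding bracket_def Let_def
    by (subst sum.reindex_bij_betw[OF bijc, symmetric])
       (auto intro!: sum.cong simp: curves card diff)
qed

lemma orbit_period_4:
  assumes "f (f (f (f x))) = x"
  shows "orbit f x = {x, f x, f (f x), f (f (f x))}"
proof
  show "orbit f x \<subseteq> {x, f x, f (f x), f (f (f x))}"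
  proof
    fix y assume "y \<in> orbit f x"
    then show "y \<in> {x, f x, f (f x), f (f (f x))}"
      by induction (use assms in auto)
  qed
  have 1: "f x \<in> orbit f x" and 2: "f (f x) \<in> orbit f x" and 3: "f (f (f x)) \<in> orbit f x"
    by (intro orbit.intros)+
  \<comment> \<open>\<open>orbit\<close> starts with the first iterate; \<open>x\<close> itself
    appears as the fourth.\<close>
  moreover have "x \<in> orbit f x"
    using orbit.step[OF 3] assms by simp
  ultimately show "{x, f x, f (f x), f (f (f x))} \<subseteq> orbit f x" by auto
qed

lemma inv_period_4:
  assumes "bij f" and "f (f (f (f x))) = x"
  shows "inv f x = f (f (f x))"
  using assms by (metis bij_inv_eq_iff)

section \<open>Colours of the corners\<close>

locale checkerboard_diagram =
  fixes D :: "('d, 'c, 'r) plane_diagram" and colour :: "'r \<Rightarrow> bool"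
  assumes link_diagram: "link_diagram D"
    and region_face_next: "d \<in> darts D \<Longrightarrow> region D (Inl (face_next D d)) = region D (Inl d)"
    and checkerboard: "checkerboard D colour"
begin

abbreviation "B \<equiv> black_corners D colour"
abbreviation "G \<equiv> tait_graph D colour"
abbreviation "M \<equiv> all_negative (medial_graph (unsigning G))"

lemma rot_permutes: "rot D permutes darts D"
  and flip_permutes: "flip D permutes darts D"
  using link_diagram by (auto simp: link_diagram_def)

lemma rot_mem [simp]: "rot D d \<in> darts D \<longleftrightarrow> d \<in> darts D"
  and flip_mem [simp]: "flip D d \<in> darts D \<longleftrightarrow> d \<in> darts D"
  and inv_rot_mem [simp]: "inv (rot D) d \<in> darts D \<longleftrightarrow> d \<in> darts D"
  and face_next_mem [simp]: "face_next D d \<in> darts D \<longleftrightarrow> d \<in> darts D"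
  using permutes_in_image[OF rot_permutes] permutes_in_image[OF flip_permutes]
    permutes_in_image[OF permutes_inv[OF rot_permutes]]
  by (auto simp: face_next_def)

lemma rot4 [simp]: "d \<in> darts D \<Longrightarrow> rot D (rot D (rot D (rot D d))) = d"
  using link_diagram by (auto simp: link_diagram_def numeral_eq_Suc)

lemma inv_rot: "d \<in> darts D \<Longrightarrow> inv (rot D) d = rot D (rot D (rot D d))"
  by (intro inv_period_4 permutes_bij[OF rot_permutes]) simp

lemma flip_flip [simp]: "d \<in> darts D \<Longrightarrow> flip D (flip D d) = d"
  using link_diagram by (auto simp: link_diagram_def)

lemma rot_over [simp]: "d \<in> darts D \<Longrightarrow> rot D d \<in> over D \<longleftrightarrow> d \<notin> over D"
  using link_diagram by (auto simp: link_diagram_def)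

lemma B_darts: "d \<in> B \<Longrightarrow> d \<in> darts D"
  by (simp add: black_corners_def)

text \<open>The dart \<open>rot D d\<close> separates the corners \<open>d\<close> and
  \<open>rot D d\<close>, so their regions are adjacent.\<close>

lemma rot_B [simp]: "d \<in> darts D \<Longrightarrow> rot D d \<in> B \<longleftrightarrow> d \<notin> B"
  using checkerboard by (auto simp: checkerboard_def adjacent_def black_corners_def)

lemma rot_face_next [simp]: "rot D (face_next D d) = flip D d"
  by (simp add: face_next_def permutes_inverses[OF rot_permutes])

lemma face_next_B [simp]: "face_next D d \<in> B \<longleftrightarrow> d \<in> B"
  using region_face_next by (auto simp: black_corners_def)

text \<open>\<open>flip D d\<close> is the rotation of \<open>face_next D d\<close>, a corner of the
  same colour as \<open>d\<close>. So each edge has exactly one dart in \<open>B\<close>.\<close>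

lemma flip_B [simp]: "d \<in> darts D \<Longrightarrow> flip D d \<in> B \<longleftrightarrow> d \<notin> B"
  using rot_B[of "face_next D d"] by simp

lemma crossing_eq:
  "d \<in> darts D \<Longrightarrow> crossing D d = {d, rot D d, rot D (rot D d), rot D (rot D (rot D d))}"
  by (simp add: crossing_def orbit_period_4)

lemma crossing_subset: "d \<in> darts D \<Longrightarrow> crossing D d \<subseteq> darts D"
  by (simp add: crossing_eq)

section \<open>Signs of crossings and the boundary walk of \<open>N\<^sub>+\<close>\<close>

lemma positive_crossing_iff:
  assumes "d \<in> B"
  shows "positive_crossing D B (crossing D d) \<longleftrightarrow> d \<in> over D"
  \<comment> \<open>Around a crossing, membership in \<open>over D\<close> and in \<open>B\<close>
    both alternate, so one dart decides.\<close>
  using assms B_darts[OF assms] by (auto simp: positive_crossing_def crossing_eq)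

text \<open>\<open>B \<inter> over D\<close> consists of the black corners at positive crossings;
  there this is \<open>opposite G\<close>.\<close>

definition exchange :: "'d \<Rightarrow> 'd" where
  "exchange h = (if h \<in> B \<inter> over D then rot D (rot D h) else h)"

lemma exchange_B [simp]: "exchange h \<in> B \<longleftrightarrow> h \<in> B"
  by (auto simp: exchange_def B_darts)

lemma exchange_exchange [simp]: "exchange (exchange h) = h"
  by (auto simp: exchange_def B_darts)

text \<open>Passing along a positive ribbon to its far end is \<open>exchange\<close>; then the walk
  continues around the black region. Outside \<open>B\<close>, \<open>perm_restrict\<close> makes
  \<open>next_half\<close> the identity.\<close>

lemma boundary_next_eq:
  "boundary_next G h = (if h \<in> B then face_next D (exchange h) else h)"
proof (cases "h \<in> B")
  case True
  then show ?thesis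
    using B_darts[OF True]
    by (simp add: boundary_next_def tait_graph_def Let_def perm_restrict_def positive_crossing_iff
        exchange_def numeral_2_eq_2)
next
  case False
  then show ?thesis
    by (simp add: boundary_next_def tait_graph_def Let_def perm_restrict_def)
qed

lemma inj_face_next: "inj (face_next D)"
proof -
  have "face_next D = inv (rot D) \<circ> flip D"
    by (simp add: fun_eq_iff face_next_def)
  then show ?thesis
    using permutes_inj[OF flip_permutes] permutes_inj[OF permutes_inv[OF rot_permutes]]
    by (simp add: inj_compose)
qed

text \<open>Serves to cancel \<open>inv (next_half R)\<close> in the medial graph. Since
  \<open>inv\<close> refers to the whole type, the fixed elements outside \<open>B\<close> are
  included.\<close>

lemma inj_boundary_next: "inj (boundary_next G)"
proof (rule injI)
  fix g h assume *: "boundary_next G g = boundary_next G h"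
  have mem: "boundary_next G x \<in> B \<longleftrightarrow> x \<in> B" for x
    by (simp add: boundary_next_eq)
  have same: "g \<in> B \<longleftrightarrow> h \<in> B"
    using mem[of g] mem[of h] * by simp
  show "g = h"
  proof (cases "g \<in> B")
    case True
    with * same have "exchange g = exchange h"
      by (simp add: boundary_next_eq inj_eq[OF inj_face_next])
    then have "exchange (exchange g) = exchange (exchange h)"
      by (rule arg_cong)
    then show ?thesis by simp
  next
    case False
    with * same show ?thesis by (simp add: boundary_next_eq)
  qed
qed

section \<open>The medial diagram and the bijection of darts\<close>

lemma darts_M: "darts M = B \<times> UNIV"
  by (simp add: all_negative_def medial_graph_def unsigning_def tait_graph_def Let_def)

lemma over_M: "over M = B \<times> {False}"
  by (auto simp: all_negative_def medial_graph_def unsigning_def tait_graph_def Let_def)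

lemma rot_M:
  "rot M (h, b) =
     (if h \<in> B then if b then (h, False) else (rot D (rot D h), True) else (h, b))"
  by (simp add: all_negative_def medial_graph_def unsigning_def tait_graph_def Let_def
      perm_restrict_def numeral_2_eq_2)

lemma rot4_M: "rot M (rot M (rot M (rot M x))) = x"
  by (cases x) (auto simp: rot_M B_darts)

lemma bij_rot_M: "bij (rot M)"
  by (rule o_bij[of "rot M \<circ> rot M \<circ> rot M"]) (simp_all add: fun_eq_iff rot4_M)

lemma inv_rot_M: "inv (rot M) x = rot M (rot M (rot M x))"
  by (intro inv_period_4 bij_rot_M rot4_M)

lemma crossing_M: "crossing M x = {x, rot M x, rot M (rot M x), rot M (rot M (rot M x))}"
  by (simp add: crossing_def orbit_period_4 rot4_M)

lemma flip_M_True: "h \<in> B \<Longrightarrow> flip M (h, True) = (boundary_next G h, False)"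
  by (simp add: all_negative_def medial_graph_def unsigning_def tait_graph_def Let_def
      perm_restrict_def)

text \<open>Phrased at a value of \<open>boundary_next G\<close>, where injectivity cancels the
  inverse in \<open>flip\<close>.\<close>

lemma flip_M_False: "h \<in> B \<Longrightarrow> flip M (boundary_next G h, False) = (h, True)"
proof -
  assume "h \<in> B"
  moreover have "half_edges G = B"
    by (simp add: tait_graph_def Let_def)
  ultimately have "boundary_next G h \<in> half_edges G" "h \<in> half_edges G"
    by (simp_all add: boundary_next_eq)
  then show ?thesis
    by (simp add: all_negative_def medial_graph_def unsigning_def Let_def
      perm_restrict_def inv_f_f[OF inj_boundary_next])
qed

text \<open>A dart in \<open>B\<close> begins the black corner of its name, any other dart ends the
  black corner \<open>inv (rot D) d\<close>; the Boolean tells these apart. Exchanging only the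
  beginnings reverses the cyclic order at positive crossings.\<close>

definition medial_dart :: "'d \<Rightarrow> 'd \<times> bool" where
  "medial_dart d = (if d \<in> B then (exchange d, True) else (inv (rot D) d, False))"

lemma bij_medial_dart: "bij_betw medial_dart (darts D) (darts M)"
  by (rule bij_betw_byWitness[where f' = "\<lambda>(h, b). if b then exchange h else rot D h"])
     (auto simp: medial_dart_def darts_M B_darts inv_rot)

text \<open>For \<open>d \<in> B\<close> the two uses of \<open>exchange\<close> cancel, leaving
  \<open>face_next D d\<close>, the black corner ended by \<open>flip D d\<close>. Otherwise the
  edge is read from its other end.\<close>

lemma flip_medial_dart:
  assumes "d \<in> darts D"
  shows "flip M (medial_dart d) = medial_dart (flip D d)"
proof (cases "d \<in> B")
  case True
  then show ?thesis
    using assms by (simp add: medial_dart_def flip_M_True boundary_next_eq face_next_def)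
next
  case False
  then have e: "flip D d \<in> B"
    using assms by simp
  have "boundary_next G (exchange (flip D d)) = inv (rot D) d"
    using assms e by (simp add: boundary_next_eq face_next_def)
  with flip_M_False[of "exchange (flip D d)"] e False show ?thesis
    by (simp add: medial_dart_def)
qed

lemma crossing_medial_dart:
  assumes "d \<in> darts D"
  shows "crossing M (medial_dart d) = medial_dart ` crossing D d"
  using assms
  by (auto simp: crossing_M crossing_eq medial_dart_def rot_M exchange_def inv_rot)

lemma smooth_mem: "d \<in> darts D \<Longrightarrow> smooth D S d \<in> darts D"
  by (simp add: smooth_def)

text \<open>For a given state, merging depends on \<open>d \<in> over D\<close> in \<open>D\<close>
  and on \<open>d \<notin> B\<close> in \<open>M\<close>. These agree at negative crossings and are
  opposite at positive ones, where \<open>medial_dart\<close> turns \<open>rot D\<close> into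
  \<open>inv (rot M)\<close> and so compensates.\<close>

lemma smooth_medial_dart:
  assumes S: "S \<subseteq> crossings D" and d: "d \<in> darts D"
  shows "smooth M (image medial_dart ` S) (medial_dart d) = medial_dart (smooth D S d)"
proof -
  have "S \<subseteq> Pow (darts D)" "crossing D d \<in> Pow (darts D)"
    using S d crossing_subset by (auto simp: crossings_def)
  then have "medial_dart ` crossing D d \<in> image medial_dart ` S \<longleftrightarrow> crossing D d \<in> S"
    using inj_on_image_Pow[OF bij_betw_imp_inj_on[OF bij_medial_dart]]
    by (intro inj_on_image_mem_iff)
  moreover have "medial_dart d \<in> over M \<longleftrightarrow> d \<notin> B"
    using d by (simp add: over_M medial_dart_def inv_rot)
  moreover have "medial_dart d \<in> darts M"
    using bij_betwE[OF bij_medial_dart] d by blast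
  ultimately have "medial_dart d \<in> merged_corners M (image medial_dart ` S)
      \<longleftrightarrow> (crossing D d \<in> S \<longleftrightarrow> d \<notin> B)"
    by (simp add: merged_corners_def crossing_medial_dart[OF d])
  moreover have "d \<in> merged_corners D S \<longleftrightarrow> (crossing D d \<in> S \<longleftrightarrow> d \<in> over D)"
    using d by (simp add: merged_corners_def)
  ultimately show ?thesis
    using d
    by (cases "crossing D d \<in> S"; cases "d \<in> B"; cases "d \<in> over D")
       (simp_all add: smooth_def inv_rot_M inv_rot medial_dart_def exchange_def rot_M)
qed

section \<open>Crossingless circles and isolated vertices\<close>

lemma circles_M: "circles M = Inr ` isolated G"
  \<comment> \<open>Each \<open>Inl\<close> disc of the unsigning meets a ribbon end.\<close>
  by (auto simp: all_negative_def medial_graph_def unsigning_def isolated_def Let_def)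

lemma curve_of_corner:
  assumes "d \<in> darts D"
  shows "Inl ` orbit (face_next D) d \<in> curves_of_region D (region D (Inl d))"
proof -
  have "e \<in> darts D \<and> region D (Inl e) = region D (Inl d)" if "e \<in> orbit (face_next D) d" for e
    using that by induction (use assms region_face_next in auto)
  then have "region D ` Inl ` orbit (face_next D) d = {region D (Inl d)}"
    using orbit.base[of "face_next D" d] by (auto simp: image_image)
  then show ?thesis
    using assms by (auto simp: curves_of_region_def boundary_curves_def)
qed

lemma curve_of_circle:
  "c \<in> circles D \<Longrightarrow> {Inr (c, b)} \<in> curves_of_region D (region D (Inr (c, b)))"
  by (auto simp: curves_of_region_def boundary_curves_def)

lemma colour_other_side:
  "c \<in> circles D \<Longrightarrow> colour (region D (Inr (c, \<not> b))) \<longleftrightarrow> \<not> colour (region D (Inr (c, b)))"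
  using checkerboard by (fastforce simp: checkerboard_def adjacent_def)

text \<open>Each circle has one black side. The region there is a disc, so this side is its whole
  boundary: it has no corners and determines the circle. Conversely, a black region without corners
  meets a circle.\<close>

lemma card_isolated:
  assumes disc: "\<And>r. r \<in> regions D \<Longrightarrow> colour r \<Longrightarrow> disc_region D r"
  shows "card (isolated G) = card (circles D)"
proof -
  \<comment> \<open>If the \<open>True\<close> side is not black, the \<open>False\<close> side
    is.\<close>
  define black_side where "black_side c = (c, colour (region D (Inr (c, True))))" for c
  let ?f = "\<lambda>c. region D (Inr (black_side c))"
  have isolated: "isolated G = {r \<in> regions D. colour r} - (\<lambda>d. region D (Inl d)) ` B"
    by (simp add: isolated_def tait_graph_def Let_def)
  have black: "colour (?f c)" if "c \<in> circles D" for c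
    using colour_other_side[OF that, of True] by (cases "colour (region D (Inr (c, True)))")
      (auto simp: black_side_def)
  have reg: "?f c \<in> regions D" if "c \<in> circles D" for c
    using that by (auto simp: regions_def black_side_def)
  have unique: "a = b" if "a \<in> curves_of_region D r" "b \<in> curves_of_region D r"
      "r \<in> regions D" "colour r" for a b r
    using disc[OF that(3,4)] that(1,2) by (auto simp: disc_region_def card_1_singleton_iff)
  have curve: "{Inr (black_side c)} \<in> curves_of_region D (?f c)" if "c \<in> circles D" for c
    using curve_of_circle[OF that] by (simp add: black_side_def)
  have "inj_on ?f (circles D)"
  proof (rule inj_onI)
    fix c c' assume *: "c \<in> circles D" "c' \<in> circles D" "?f c = ?f c'"
    then have "{Inr (black_side c)} = ({Inr (black_side c')} :: ('d + 'c \<times> bool) set)"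
      using unique curve[of c] curve[of c'] reg[of c] black[of c] by metis
    then show "c = c'" by (simp add: black_side_def)
  qed
  moreover have "?f ` circles D = isolated G"
  proof (intro equalityI subsetI)
    fix r assume "r \<in> ?f ` circles D"
    then obtain c where c: "c \<in> circles D" "r = ?f c" by auto
    have "r \<noteq> region D (Inl d)" if "d \<in> darts D" for d
    proof
      assume r: "r = region D (Inl d)"
      have "r \<in> regions D" "colour r"
        using reg[OF c(1)] black[OF c(1)] c(2) by simp_all
      \<comment> \<open>The only boundary curve of a disc cannot be both a circle side and a walk
        along corners.\<close>
      then have "{Inr (black_side c)} = Inl ` orbit (face_next D) d"
        using unique[OF curve[OF c(1), folded c(2)]] curve_of_corner[OF that, folded r] by blast
      then show False by auto
    qed
    then show "r \<in> isolated G"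
      using c reg black B_darts by (auto simp: isolated)
  next
    fix r assume "r \<in> isolated G"
    then have r: "r \<in> regions D" "colour r" "r \<notin> (\<lambda>d. region D (Inl d)) ` B"
      by (auto simp: isolated)
    then have "r \<noteq> region D (Inl d)" if "d \<in> darts D" for d
      using that by (auto simp: black_corners_def)
    \<comment> \<open>\<open>regions D\<close> contains \<open>unbounded D\<close> even if no side
      lies there; being white, it is excluded.\<close>
    moreover have "r \<noteq> unbounded D"
      using r checkerboard by (auto simp: checkerboard_def)
    ultimately obtain c b where c: "c \<in> circles D" "r = region D (Inr (c, b))"
      using r by (auto simp: regions_def)
    then have "black_side c = (c, b)"
      using r colour_other_side[OF c(1), of True] by (cases b) (auto simp: black_side_def)
    then show "r \<in> ?f ` circles D"
      using c by (auto intro!: image_eqI[of _ _ c])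
  qed
  ultimately show ?thesis
    using card_image by metis
qed

end

theorem theorem6:
  fixes D :: "('d, 'c, 'r) plane_diagram" and colour :: "'r \<Rightarrow> bool"
  assumes "plane_link_diagram D"
    and "checkerboard D colour"
    and "\<And>r. r \<in> regions D \<Longrightarrow> colour r \<Longrightarrow> disc_region D r"
  shows "bracket D = bracket (all_negative (medial_graph (unsigning (tait_graph D colour))))"
proof -
  interpret checkerboard_diagram D colour
    using assms(1,2) by unfold_locales (auto simp: plane_link_diagram_def)
  show ?thesis
  proof (rule bracket_eqI[OF bij_medial_dart])
    show "card (circles D) = card (circles M)"
      by (simp add: circles_M card_image card_isolated[OF assms(3)])
  qed (simp_all add: crossing_medial_dart crossing_subset flip_medial_dart smooth_mem
      smooth_medial_dart)
qed

end
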